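(* Let $n\ge 2$ and let $\varphi\in\Phi$ satisfy $\varphi>0$ on $(0,\infty)$. Suppose that for all $K,L\in\mathcal{K}^n_o$ there is a compact convex set $K*_\varphi L$ in $\mathbb{R}^n$ such that $$h_{K*_\varphi L}(x)=\varphi^{-1}\left(\varphi\left(h_K(x)\right)+\varphi\left(h_L(x)\right)\right)\quad\text{for all }x\in\mathbb{R}^n.$$ Then $\varphi(t)=t^p$ (for all $t\ge 0$) for some $p\ge 1$.
   Context: $\mathcal{K}^n_o$ is the class of compact convex subsets of $\mathbb{R}^n$ containing the origin. $h_K(x)=\sup\{x\cdot y:y\in K\}$ is the support function of $K$. $\Phi$ is the set of convex functions $\varphi:[0,\infty)\to[0,\infty)$ that are increasing (i.e. nondecreasing) and satisfy $\varphi(0)=0$ and $\varphi(1)=1$. If in addition $\varphi>0$ on $(0,\infty)$, then $\varphi$ is a bijection of $[0,\infty)$ and $\varphi^{-1}$ denotes its inverse. *)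

theory Defs
  imports "HOL-Analysis.Analysis"
begin

(* The real-valued supremum is meaningful only for nonempty bounded K. *)
definition support_function :: "'a::real_inner set \<Rightarrow> 'a \<Rightarrow> real" where
  "support_function K x = Sup ((\<lambda>y. x \<bullet> y) ` K)"

definition compact_convex_origin :: "'a::euclidean_space set set" where
  "compact_convex_origin = {K. compact K \<and> convex K \<and> 0 \<in> K}"

(* A function on [0,\<infinity>) is a total function on the reals whose values
   at negative arguments are irrelevant. *)
definition Phi_class :: "(real \<Rightarrow> real) set" where
  "Phi_class = {\<phi>. \<phi> \<in> {0..} \<rightarrow> {0..} \<and> convex_on {0..} \<phi> \<and> mono_on {0..} \<phi>
                 \<and> \<phi> 0 = 0 \<and> \<phi> 1 = 1}"

end

theory Submission
  imports Defs
begin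

text \<open>Support functions are positively homogeneous, so applying the hypothesis to balls shows that
  \<open>F(a, b) = \<phi>\<^sup>-\<^sup>1(\<phi>(a) + \<phi>(b))\<close> satisfies \<open>F(ra, rb) = r F(a, b)\<close>.  Hence for fixed \<open>r\<close> the map
  \<open>u \<mapsto> \<phi>(r \<phi>\<^sup>-\<^sup>1(u))\<close> is additive and nonnegative on \<open>[0, \<infinity>)\<close>, therefore linear, which means that
  \<open>\<phi>\<close> is multiplicative.  Passing to \<open>x \<mapsto> ln \<phi>(e\<^sup>x)\<close>, the same linearity argument shows that \<open>\<phi>\<close>
  is a power, and convexity forces the exponent to be at least 1.\<close>

text \<open>Nonnegativity makes \<open>f\<close> monotone on [0, \<infinity>), so with
  \<open>k\<close> the floor of \<open>n * u\<close> both \<open>n * f u\<close> and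
  \<open>n * u * f 1\<close> lie between \<open>k * f 1\<close> and \<open>(k + 1) * f 1\<close>.
  Their distance is at most \<open>f 1\<close> for every \<open>n\<close>, which forces equality by
  the Archimedean property.\<close>

lemma additive_nonneg_imp_linear:
  fixes f :: "real \<Rightarrow> real"
  assumes add: "\<And>x y. x \<ge> 0 \<Longrightarrow> y \<ge> 0 \<Longrightarrow> f (x + y) = f x + f y"
    and nonneg: "\<And>x. x \<ge> 0 \<Longrightarrow> f x \<ge> 0"
    and u: "u \<ge> 0"
  shows "f u = u * f 1"
proof -
  have f0: "f 0 = 0"
    using add[of 0 0] by simp
  have mult: "f (real n * x) = real n * f x" if "x \<ge> 0" for n x
    by (induction n) (use that f0 in \<open>auto simp: add algebra_simps\<close>)
  have mono: "f x \<le> f y" if "0 \<le> x" "x \<le> y" for x y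
    using add[of x "y - x"] nonneg[of "y - x"] that by simp
  have bound: "real n * \<bar>f u - u * f 1\<bar> \<le> f 1" for n
  proof -
    define k where "k = nat \<lfloor>real n * u\<rfloor>"
    have k: "real k \<le> real n * u" "real n * u \<le> real (Suc k)"
      using u unfolding k_def by (auto; linarith)+
    have "real k * f 1 \<le> real n * f u" "real n * f u \<le> real (Suc k) * f 1"
      using mono[OF _ k(1)] mono[OF _ k(2)] mult[of 1 k] mult[of 1 "Suc k"] mult[OF u, of n] u
      by auto
    moreover have "real k * f 1 \<le> real n * u * f 1" "real n * u * f 1 \<le> real (Suc k) * f 1"
      using k nonneg[of 1] by (auto intro!: mult_right_mono)
    ultimately have "\<bar>real n * f u - real n * u * f 1\<bar> \<le> f 1"
      by (simp add: algebra_simps abs_le_iff)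
    moreover have "real n * f u - real n * u * f 1 = real n * (f u - u * f 1)"
      by (simp add: algebra_simps)
    ultimately show ?thesis
      by (simp add: abs_mult)
  qed
  show ?thesis
  proof (rule ccontr)
    assume "f u \<noteq> u * f 1"
    then obtain n where "f 1 < real n * \<bar>f u - u * f 1\<bar>"
      using reals_Archimedean3[of "\<bar>f u - u * f 1\<bar>"] by auto
    with bound[of n] show False by simp
  qed
qed

lemma multiplicative_imp_powr:
  fixes \<phi> :: "real \<Rightarrow> real"
  assumes mult: "\<And>s t. s > 0 \<Longrightarrow> t > 0 \<Longrightarrow> \<phi> (s * t) = \<phi> s * \<phi> t"
    and pos: "\<And>t. t > 0 \<Longrightarrow> \<phi> t > 0"
    and ge1: "\<And>t. t \<ge> 1 \<Longrightarrow> \<phi> t \<ge> 1"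
    and t: "t > 0"
  shows "\<phi> t = t powr ln (\<phi> (exp 1))"
proof -
  define g where "g x = ln (\<phi> (exp x))" for x
  have add: "g (x + y) = g x + g y" for x y
    unfolding g_def using pos[of "exp x"] pos[of "exp y"]
    by (simp add: exp_add mult ln_mult)
  \<comment> \<open>The hypothesis \<open>ge1\<close> is exactly nonnegativity of \<open>g\<close>
    on [0, \<infinity>); additivity then carries linearity over to negative arguments.\<close>
  have lin: "g x = x * g 1" if "x \<ge> 0" for x
    by (rule additive_nonneg_imp_linear) (use that add in \<open>auto simp: g_def ge1\<close>)
  have "g x = x * g 1" for x
    using lin[of x] lin[of "- x"] add[of x "- x"] lin[of 0] by (cases "x \<ge> 0") auto
  from this[of "ln t"] have "ln (\<phi> t) = ln t * ln (\<phi> (exp 1))"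
    using t by (simp add: g_def)
  with pos[OF t] t show ?thesis
    by (metis exp_ln mult.commute powr_def less_irrefl)
qed

lemma support_function_cball:
  fixes x :: "'a::euclidean_space"
  assumes "a \<ge> 0"
  shows "support_function (cball 0 a) x = a * norm x"
  unfolding support_function_def
proof (rule cSup_eq_maximum)
  \<comment> \<open>The maximiser is the boundary point in direction \<open>x\<close>. For
    \<open>x = 0\<close> division by zero makes it the origin, which still works.\<close>
  have "x \<bullet> ((a / norm x) *\<^sub>R x) = a * norm x"
    by (simp add: dot_square_norm power2_eq_square)
  moreover have "(a / norm x) *\<^sub>R x \<in> cball 0 a"
    using assms by simp
  ultimately show "a * norm x \<in> (\<bullet>) x ` cball 0 a"
    by (metis imageI)
next
  fix z assume "z \<in> (\<bullet>) x ` cball 0 a"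
  then obtain y where y: "z = x \<bullet> y" "norm y \<le> a" by auto
  have "x \<bullet> y \<le> norm x * norm y"
    by (rule norm_cauchy_schwarz)
  also have "\<dots> \<le> norm x * a"
    using y(2) by (simp add: mult_left_mono)
  finally show "z \<le> a * norm x"
    using y(1) by (simp add: mult.commute)
qed

text \<open>By compactness the supremum is attained at some \<open>y\<close>, and since
  \<open>r\<close> is nonnegative the same \<open>y\<close> is a maximiser for
  \<open>r *\<^sub>R x\<close>.\<close>

lemma support_function_scaleR:
  fixes M :: "'a::euclidean_space set"
  assumes "compact M" "M \<noteq> {}" "r \<ge> 0"
  shows "support_function M (r *\<^sub>R x) = r * support_function M x"
proof -
  obtain y where y: "y \<in> M" "\<And>z. z \<in> M \<Longrightarrow> x \<bullet> z \<le> x \<bullet> y"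
    using continuous_attains_sup[OF assms(1,2), of "\<lambda>y. x \<bullet> y"]
      continuous_on_inner[OF continuous_on_const continuous_on_id] by blast
  have "support_function M x = x \<bullet> y"
    unfolding support_function_def by (rule cSup_eq_maximum) (use y in auto)
  moreover have "support_function M (r *\<^sub>R x) = r * (x \<bullet> y)"
    unfolding support_function_def
    by (rule cSup_eq_maximum) (use y assms(3) in \<open>auto intro!: mult_left_mono image_eqI[where x = y]\<close>)
  ultimately show ?thesis by simp
qed

text \<open>The graph lies below the chord from the origin, so \<open>\<phi> t / t\<close> is
  nondecreasing; the form without quotients covers \<open>s = 0\<close> as well.\<close>

lemma Phi_class_star:
  assumes "\<phi> \<in> Phi_class" "0 \<le> s" "s \<le> t" "t > 0"
  shows "t * \<phi> s \<le> s * \<phi> t"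
proof -
  have "convex_on {0..} \<phi>" "\<phi> 0 = 0"
    using assms(1) by (auto simp: Phi_class_def)
  from convex_onD[OF this(1), of "s / t" 0 t] this(2) assms(2-)
  have "\<phi> s \<le> s / t * \<phi> t"
    by simp
  with assms(4) show ?thesis
    by (simp add: field_simps)
qed

lemma Phi_class_continuous_on:
  assumes "\<phi> \<in> Phi_class"
  shows "continuous_on {0..} \<phi>"
proof -
  have conv: "convex_on {0..} \<phi>" and ge: "\<And>t. t \<ge> 0 \<Longrightarrow> \<phi> t \<ge> 0" and "\<phi> 0 = 0" "\<phi> 1 = 1"
    using assms by (auto simp: Phi_class_def)
  have "continuous_on {0<..} \<phi>"
    by (rule convex_on_continuous) (auto intro: convex_on_subset[OF conv])
  then have pos: "isCont \<phi> t" if "t > 0" for t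
    using that by (simp add: continuous_on_eq_continuous_at)
  \<comment> \<open>Convexity yields continuity only in the interior. At the endpoint 0 it comes
    from the bounds \<open>0 \<le> \<phi> t \<le> t\<close> on [0, 1].\<close>
  have "(\<phi> \<longlongrightarrow> 0) (at 0 within {0..})"
  proof (rule tendsto_sandwich)
    have ev: "\<forall>\<^sub>F t in at 0 within {0..}. t \<in> {0..(1::real)}"
      by (auto simp: eventually_at intro!: exI[of _ 1])
    show "\<forall>\<^sub>F t in at 0 within {0..}. 0 \<le> \<phi> t"
      using ev by eventually_elim (use ge in auto)
    show "\<forall>\<^sub>F t in at 0 within {0..}. \<phi> t \<le> t"
      using ev by eventually_elim (use Phi_class_star[OF assms, of _ 1] \<open>\<phi> 1 = 1\<close> in auto)
  qed (auto intro: tendsto_intros)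
  then have "continuous (at 0 within {0..}) \<phi>"
    using \<open>\<phi> 0 = 0\<close> by (simp add: continuous_within)
  with pos show ?thesis
    by (metis atLeast_iff continuous_at_imp_continuous_at_within continuous_on_eq_continuous_within
        less_eq_real_def)
qed

lemma Phi_class_bij_betw:
  assumes \<phi>: "\<phi> \<in> Phi_class" and pos: "\<forall>t>0. \<phi> t > 0"
  shows "bij_betw \<phi> {0..} {0..}"
proof -
  have "\<phi> s < \<phi> t" if "0 \<le> s" "s < t" for s t
  proof -
    have "t * \<phi> s \<le> s * \<phi> t"
      using Phi_class_star[OF \<phi>, of s t] that by simp
    also have "\<dots> < t * \<phi> t"
      using that pos by (simp add: mult_strict_right_mono)
    finally show ?thesis
      using that by simp
  qed
  then have "inj_on \<phi> {0..}"
    by (intro linorder_inj_onI) (auto simp: less_le)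
  moreover have "\<phi> ` {0..} = {0..}"
  proof
    show "\<phi> ` {0..} \<subseteq> {0..}"
      using \<phi> by (auto simp: Phi_class_def)
    show "{0..} \<subseteq> \<phi> ` {0..}"
    proof
      fix u :: real assume "u \<in> {0..}"
      \<comment> \<open>This gives the right endpoint for the intermediate value theorem. The
        maximum with 1 is taken because the chord bound gives \<open>t \<le> \<phi> t\<close> for
        \<open>t \<ge> 1\<close>.\<close>
      moreover have "max 1 u \<le> \<phi> (max 1 u)"
        using Phi_class_star[OF \<phi>, of 1 "max 1 u"] \<phi> by (simp add: Phi_class_def)
      moreover have "continuous_on {0..max 1 u} \<phi>"
        by (rule continuous_on_subset[OF Phi_class_continuous_on[OF \<phi>]]) auto
      ultimately obtain t where "0 \<le> t" "\<phi> t = u"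
        using IVT'[of \<phi> 0 u "max 1 u"] \<phi> by (auto simp: Phi_class_def le_max_iff_disj)
      then show "u \<in> \<phi> ` {0..}" by auto
    qed
  qed
  ultimately show ?thesis
    by (simp add: bij_betw_def)
qed

lemma homogeneous_imp_multiplicative:
  fixes \<phi> :: "real \<Rightarrow> real"
  defines "\<psi> \<equiv> inv_into {0..} \<phi>"
  assumes bij: "bij_betw \<phi> {0..} {0..}" and one: "\<phi> 1 = 1"
    and hom: "\<And>r a b. r \<ge> 0 \<Longrightarrow> a \<ge> 0 \<Longrightarrow> b \<ge> 0 \<Longrightarrow>
                \<psi> (\<phi> (r * a) + \<phi> (r * b)) = r * \<psi> (\<phi> a + \<phi> b)"
    and r: "r \<ge> 0" and t: "t \<ge> 0"
  shows "\<phi> (r * t) = \<phi> r * \<phi> t"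
proof -
  have \<phi>_nonneg: "\<phi> x \<ge> 0" and left: "\<psi> (\<phi> x) = x" if "x \<ge> 0" for x
    using bij that by (auto simp: \<psi>_def bij_betw_def)
  have \<psi>_nonneg: "\<psi> u \<ge> 0" and right: "\<phi> (\<psi> u) = u" if "u \<ge> 0" for u
    using bij that bij_betw_inv_into_right[OF bij, of u] inv_into_into[of u \<phi> "{0..}"]
    by (auto simp: \<psi>_def bij_betw_def)
  \<comment> \<open>This is linearity of \<open>u \<mapsto> \<phi> (r * \<psi> u)\<close> evaluated
    at \<open>u = \<phi> t\<close>; its slope is \<open>\<phi> r\<close> because
    \<open>\<psi> 1 = 1\<close>.\<close>
  have "\<phi> (r * \<psi> (\<phi> t)) = \<phi> t * \<phi> (r * \<psi> 1)"
  proof (rule additive_nonneg_imp_linear)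
    fix u v :: real assume "u \<ge> 0" "v \<ge> 0"
    then have "r * \<psi> (u + v) = \<psi> (\<phi> (r * \<psi> u) + \<phi> (r * \<psi> v))"
      using hom[OF r, of "\<psi> u" "\<psi> v"] by (simp add: \<psi>_nonneg right)
    with r \<open>u \<ge> 0\<close> \<open>v \<ge> 0\<close> show "\<phi> (r * \<psi> (u + v)) = \<phi> (r * \<psi> u) + \<phi> (r * \<psi> v)"
      by (simp add: right \<phi>_nonneg \<psi>_nonneg)
  qed (use r t in \<open>auto simp: \<phi>_nonneg \<psi>_nonneg\<close>)
  moreover have "\<psi> 1 = 1"
    using left[of 1] one by simp
  ultimately show ?thesis
    using t by (simp add: left mult.commute)
qed

theorem theorem10p1:
  fixes \<phi> :: "real \<Rightarrow> real"
  assumes "CARD('n::finite) \<ge> 2"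
    and "\<phi> \<in> Phi_class"
    and "\<forall>t>0. \<phi> t > 0"
    and "\<forall>K\<in>compact_convex_origin. \<forall>L\<in>compact_convex_origin.
           \<exists>M :: (real ^ 'n) set. compact M \<and> convex M \<and> M \<noteq> {} \<and>
             (\<forall>x. support_function M x =
                inv_into {0..} \<phi> (\<phi> (support_function (K :: (real ^ 'n) set) x)
                                  + \<phi> (support_function (L :: (real ^ 'n) set) x)))"
  shows "\<exists>p\<ge>1. \<forall>t\<ge>0. \<phi> t = t powr p"
proof -
  have zero: "\<phi> 0 = 0" and one: "\<phi> 1 = 1"
    using assms(2) by (auto simp: Phi_class_def)
  have hom: "inv_into {0..} \<phi> (\<phi> (r * a) + \<phi> (r * b)) = r * inv_into {0..} \<phi> (\<phi> a + \<phi> b)"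
    if "r \<ge> 0" "a \<ge> 0" "b \<ge> 0" for r a b
  proof -
    have "cball (0 :: real ^ 'n) a \<in> compact_convex_origin"
      "cball (0 :: real ^ 'n) b \<in> compact_convex_origin"
      using that by (auto simp: compact_convex_origin_def)
    with assms(4) obtain M :: "(real ^ 'n) set" where M: "compact M" "M \<noteq> {}"
      "\<And>x. support_function M x = inv_into {0..} \<phi> (\<phi> (support_function (cball (0 :: real ^ 'n) a) x)
                                    + \<phi> (support_function (cball (0 :: real ^ 'n) b) x))"
      by blast
    \<comment> \<open>At \<open>e\<close> the two balls have support values \<open>a\<close> and
      \<open>b\<close>, at \<open>r *\<^sub>R e\<close> they have \<open>r * a\<close> and
      \<open>r * b\<close>; homogeneity of the support function of \<open>M\<close> links the two
      evaluations.\<close>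
    obtain e :: "real ^ 'n" where e: "norm e = 1"
      using vector_choose_size[of 1] by auto
    show ?thesis
      using support_function_scaleR[OF M(1,2) that(1), of e] that e
      by (simp add: M(3) support_function_cball mult.commute)
  qed
  have ge: "t \<le> \<phi> t" if "t \<ge> 1" for t
    using Phi_class_star[OF assms(2), of 1 t] that one by simp
  define p where "p = ln (\<phi> (exp 1))"
  have "\<phi> t = t powr p" if "t > 0" for t
    unfolding p_def
  proof (rule multiplicative_imp_powr)
    show "\<phi> (r * s) = \<phi> r * \<phi> s" if "r > 0" "s > 0" for r s
      by (rule homogeneous_imp_multiplicative[OF Phi_class_bij_betw[OF assms(2,3)] one])
        (use that hom in auto)
    show "\<phi> s \<ge> 1" if "s \<ge> 1" for s
      using ge[OF that] that by simp
  qed (use assms(3) that in auto)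
  \<comment> \<open>At \<open>t = 0\<close> both sides vanish, since \<open>0 powr p = 0\<close> for
    every \<open>p\<close>.\<close>
  then have "\<forall>t\<ge>0. \<phi> t = t powr p"
    using zero by (auto simp: le_less)
  \<comment> \<open>Convexity enters through \<open>t \<le> \<phi> t\<close> at
    \<open>t = exp 1\<close>; taking logarithms gives the bound.\<close>
  moreover have "p \<ge> 1"
    using ge[of "exp 1"] ln_mono[of "exp 1" "\<phi> (exp 1)"] by (simp add: p_def)
  ultimately show ?thesis by blast
qed

end
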